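(* Let $T=\sum_{j=0}^k Q_j(x)\frac{d^j}{dx^j}$ be a linear ordinary differential operator of finite order $k\ge 1$ with polynomial coefficients $Q_j\in\mathbb{C}[x]$, $Q_k\not\equiv 0$, and let $n$ be a non-negative integer. Then the following hold. (1) Every nonempty set $S\in\mathcal{I}^T_{\ge n}$ is convex. (2) If $S\in\mathcal{I}^T_{\ge n}$ is unbounded, then $S$ is $T$-invariant, i.e. $S\in\mathcal{I}^T_{\ge 0}$. (3) If $Q_k$ is not a constant polynomial, then every nonempty $S\in\mathcal{I}^T_{\ge n}$ contains the fundamental polygon $\mathrm{Conv}(Q_k)$. (4) If $Q_k$ is not a constant polynomial, then the collection of nonempty sets in $\mathcal{I}^T_{\ge n}$ has a unique minimal element with respect to inclusion.
   Context: For a linear operator $T:\mathbb{C}[x]\to\mathbb{C}[x]$ and an integer $n\ge 0$, $\mathcal{I}^T_{\ge n}$ denotes the collection of all closed subsets $S\subseteq\mathbb{C}$ such that for every polynomial $p$ of degree at least $n$ with all roots in $S$, the polynomial $T(p)$ is either $0$ or has all its roots in $S$ (a nonzero constant polynomial has no roots, so the condition is vacuous for it). A closed set in $\mathcal{I}^T_{\ge 0}$ is called $T$-invariant. A nonempty set $S\in \mathcal{I}^T_{\ge n}$ is minimal if no nonempty closed proper subset of $S$ belongs to $\mathcal{I}^T_{\ge n}$. When $Q_k$ is non-constant, $\mathrm{Conv}(Q_k)\subset\mathbb{C}$ (the fundamental polygon of $T$) is the convex hull of the set of zeros of $Q_k$. *)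

theory Defs
  imports "HOL-Analysis.Analysis" "HOL-Computational_Algebra.Polynomial"
begin

definition diff_op :: "nat \<Rightarrow> (nat \<Rightarrow> complex poly) \<Rightarrow> complex poly \<Rightarrow> complex poly" where
  "diff_op k Q p = (\<Sum>j\<le>k. Q j * (pderiv ^^ j) p)"

definition zeros :: "complex poly \<Rightarrow> complex set" where
  "zeros p = {z. poly p z = 0}"

(* The zero polynomial has degree 0 in the library, hence the condition p \<noteq> 0;
   it makes no difference for linear T, since then T 0 = 0. *)
definition invariant_sets :: "(complex poly \<Rightarrow> complex poly) \<Rightarrow> nat \<Rightarrow> complex set set" where
  "invariant_sets T n =
     {S. closed S \<and>
         (\<forall>p. p \<noteq> 0 \<and> degree p \<ge> n \<and> zeros p \<subseteq> S \<longrightarrow> T p = 0 \<or> zeros (T p) \<subseteq> S)}"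

definition T_invariant :: "(complex poly \<Rightarrow> complex poly) \<Rightarrow> complex set \<Rightarrow> bool" where
  "T_invariant T S \<longleftrightarrow> S \<in> invariant_sets T 0"

definition minimal_invariant ::
  "(complex poly \<Rightarrow> complex poly) \<Rightarrow> nat \<Rightarrow> complex set \<Rightarrow> bool" where
  "minimal_invariant T n S \<longleftrightarrow>
     S \<in> invariant_sets T n \<and> S \<noteq> {} \<and>
     \<not> (\<exists>R. R \<noteq> {} \<and> closed R \<and> R \<subset> S \<and> R \<in> invariant_sets T n)"

definition fundamental_polygon :: "nat \<Rightarrow> (nat \<Rightarrow> complex poly) \<Rightarrow> complex set" where
  "fundamental_polygon k Q = convex hull (zeros (Q k))"

end

theory Submission
  imports Defs "HOL-Computational_Algebra.Fundamental_Theorem_Algebra"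
begin

text \<open>
  If every \<open>F N\<close> is zero or has all its roots in a closed set \<open>S\<close>, the degrees are bounded and
  \<open>F N\<close> converges coefficientwise to \<open>G\<close>, then \<open>G\<close> is zero or has all its roots in \<open>S\<close>:
  a polynomial \<open>p\<close> without roots in the ball of radius \<open>r\<close> around \<open>z\<close> satisfies
  \<open>\<bar>p x\<bar> \<le> \<bar>p z\<bar> * (1 + \<bar>x - z\<bar> / r) ^ degree p\<close>, so \<open>G z = 0\<close> would force \<open>G = 0\<close>.

  For \<open>q\<close> with all roots in \<open>S\<close>, \<open>T (q ^ N)\<close> is \<open>N ^ k * q ^ (N - k)\<close> times a polynomial that
  converges to \<open>Q k * q' ^ k\<close>. Hence \<open>S\<close> contains the roots of \<open>Q k\<close>, and \<open>q = (x - a) (x - b)\<close>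
  shows that it contains the midpoint of \<open>a\<close> and \<open>b\<close>.

  If \<open>S\<close> is unbounded and \<open>p\<close> has low degree, take \<open>w N \<in> S\<close> with \<open>w N \<rightarrow> \<infinity>\<close>; then
  \<open>p * (1 - x / w N) ^ n\<close> has degree at least \<open>n\<close> and converges to \<open>p\<close>.
\<close>

section \<open>Coefficientwise convergence of polynomials of bounded degree\<close>

text \<open>The uniform degree bound makes evaluation continuous: the powers \<open>x ^ N\<close>
  tend to 0 coefficientwise, but not at \<open>x = 1\<close>.\<close>

definition poly_tendsto ::
    "(nat \<Rightarrow> 'a::real_normed_field poly) \<Rightarrow> 'a poly \<Rightarrow> bool" where
  "poly_tendsto F G \<longleftrightarrow>
     (\<exists>D. \<forall>N. degree (F N) \<le> D) \<and> (\<forall>i. (\<lambda>N. coeff (F N) i) \<longlonglongrightarrow> coeff G i)"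

lemma poly_tendsto_const: "poly_tendsto (\<lambda>_. p) p"
  by (auto simp: poly_tendsto_def)

lemma poly_tendsto_add:
  assumes "poly_tendsto F G" "poly_tendsto F' G'"
  shows "poly_tendsto (\<lambda>N. F N + F' N) (G + G')"
proof -
  obtain D D' where "\<And>N. degree (F N) \<le> D" "\<And>N. degree (F' N) \<le> D'"
    using assms by (auto simp: poly_tendsto_def)
  then have "degree (F N + F' N) \<le> max D D'" for N
    by (intro degree_add_le) (auto intro: max.coboundedI1 max.coboundedI2)
  then show ?thesis
    using assms by (auto simp: poly_tendsto_def intro!: tendsto_intros)
qed

lemma poly_tendsto_mult:
  assumes "poly_tendsto F G" "poly_tendsto F' G'"
  shows "poly_tendsto (\<lambda>N. F N * F' N) (G * G')"
proof -
  obtain D D' where D: "\<And>N. degree (F N) \<le> D" "\<And>N. degree (F' N) \<le> D'"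
    using assms by (auto simp: poly_tendsto_def)
  have "degree (F N * F' N) \<le> D + D'" for N
    using degree_mult_le[of "F N" "F' N"] D[of N] by linarith
  then show ?thesis
    using assms by (auto simp: poly_tendsto_def coeff_mult intro!: tendsto_intros)
qed

lemma poly_tendsto_smult:
  assumes "c \<longlonglongrightarrow> c'" "poly_tendsto F G"
  shows "poly_tendsto (\<lambda>N. smult (c N) (F N)) (smult c' G)"
  using assms by (auto simp: poly_tendsto_def intro!: tendsto_intros intro: order_trans[OF degree_smult_le])

lemma poly_tendsto_pderiv:
  assumes "poly_tendsto F G"
  shows "poly_tendsto (\<lambda>N. pderiv (F N)) (pderiv G)"
proof -
  obtain D where "\<And>N. degree (F N) \<le> D"
    using assms by (auto simp: poly_tendsto_def)
  then have "degree (pderiv (F N)) \<le> D" for N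
    unfolding degree_pderiv by (meson diff_le_self order_trans)
  then show ?thesis
    using assms by (auto simp: poly_tendsto_def coeff_pderiv intro!: tendsto_intros)
qed

lemma poly_tendsto_sum:
  assumes "finite I" "\<And>i. i \<in> I \<Longrightarrow> poly_tendsto (F i) (G i)"
  shows "poly_tendsto (\<lambda>N. \<Sum>i\<in>I. F i N) (\<Sum>i\<in>I. G i)"
  using assms by (induction I) (auto intro: poly_tendsto_add poly_tendsto_const)

lemma poly_tendsto_power:
  assumes "poly_tendsto F G"
  shows "poly_tendsto (\<lambda>N. F N ^ m) (G ^ m)"
  using assms by (induction m) (auto intro: poly_tendsto_mult poly_tendsto_const)

lemma poly_tendsto_imp_tendsto_poly:
  assumes "poly_tendsto F G"
  shows "(\<lambda>N. poly (F N) x) \<longlonglongrightarrow> poly G x"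
proof -
  obtain D where D: "\<And>N. degree (F N) \<le> D"
    using assms by (auto simp: poly_tendsto_def)
  \<comment> \<open>All \<open>F N\<close> and \<open>G\<close> are written as sums over one index
    range, so that the limit can be taken termwise.\<close>
  have eq: "poly p x = (\<Sum>i\<le>max D (degree G). coeff p i * x ^ i)"
    if "degree p \<le> max D (degree G)" for p
    unfolding poly_altdef using that
    by (intro sum.mono_neutral_left) (auto simp: coeff_eq_0)
  have "(\<lambda>N. \<Sum>i\<le>max D (degree G). coeff (F N) i * x ^ i)
          \<longlonglongrightarrow> (\<Sum>i\<le>max D (degree G). coeff G i * x ^ i)"
    using assms by (auto simp: poly_tendsto_def intro!: tendsto_intros)
  then show ?thesis
    using D by (simp add: eq le_max_iff_disj)
qed

lemma poly_tendsto_diff_op: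
  assumes "poly_tendsto F G"
  shows "poly_tendsto (\<lambda>N. diff_op k Q (F N)) (diff_op k Q G)"
proof -
  have "poly_tendsto (\<lambda>N. (pderiv ^^ j) (F N)) ((pderiv ^^ j) G)" for j
    by (induction j) (auto intro: assms poly_tendsto_pderiv)
  then show ?thesis
    unfolding diff_op_def by (intro poly_tendsto_sum poly_tendsto_mult poly_tendsto_const) auto
qed

section \<open>Zeros of limits\<close>

text \<open>Each root \<open>a\<close> has \<open>dist z a\<close> \<ge> \<open>r\<close>, so
  \<open>dist x z\<close> \<le> \<open>dist z a * (dist x z / r)\<close>, and the triangle
  inequality bounds \<open>dist x a\<close> by \<open>dist z a * (1 + dist x z / r)\<close>.
  Splitting off the roots one by one multiplies these bounds.\<close>

lemma norm_poly_le_if_zero_free_ball: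
  fixes p :: "complex poly"
  assumes "r > 0" "zeros p \<inter> ball z r = {}"
  shows "cmod (poly p x) \<le> cmod (poly p z) * (1 + dist x z / r) ^ degree p"
  using assms(2)
proof (induction "degree p" arbitrary: p)
  case 0
  then show ?case by (metis degree_eq_zeroE mult.right_neutral order_refl poly_const_conv power_0)
next
  case (Suc d)
  then have "\<not> constant (poly p)"
    by (simp add: constant_degree)
  then obtain a where "poly p a = 0"
    using fundamental_theorem_of_algebra by blast
  then obtain s where s: "p = [:-a, 1:] * s"
    by (auto simp: poly_eq_0_iff_dvd)
  with Suc.hyps(2) have "s \<noteq> 0" by auto
  with Suc.hyps(2) s have "d = degree s"
    by (simp add: degree_mult_eq del: mult_pCons_left)
  moreover have "zeros s \<inter> ball z r = {}"
    using Suc.prems s by (auto simp: zeros_def)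
  ultimately have IH: "cmod (poly s x) \<le> cmod (poly s z) * (1 + dist x z / r) ^ d"
    using Suc.hyps(1) by simp
  have "r \<le> dist z a"
    using Suc.prems \<open>poly p a = 0\<close> by (force simp: zeros_def)
  then have "r * (dist x z / r) \<le> dist z a * (dist x z / r)"
    using \<open>r > 0\<close> by (intro mult_right_mono) auto
  then have "dist x a \<le> dist z a * (1 + dist x z / r)"
    using dist_triangle[of x a z] \<open>r > 0\<close> by (simp add: distrib_left)
  then have "dist x a * cmod (poly s x)
      \<le> (dist z a * (1 + dist x z / r)) * (cmod (poly s z) * (1 + dist x z / r) ^ d)"
    using IH \<open>r > 0\<close> by (intro mult_mono) auto
  moreover have "cmod (poly p y) = dist y a * cmod (poly s y)" for y
    by (simp add: s dist_norm norm_mult del: mult_pCons_left)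
  ultimately show ?case
    by (simp add: Suc.hyps(2)[symmetric] mult_ac)
qed

lemma zeros_limit_subset:
  assumes "closed S" and F: "poly_tendsto F G"
    and ev: "\<forall>\<^sub>F N in sequentially. F N = 0 \<or> zeros (F N) \<subseteq> S"
  shows "G = 0 \<or> zeros G \<subseteq> S"
proof (rule ccontr)
  assume "\<not> ?thesis"
  then obtain z where "G \<noteq> 0" and z: "poly G z = 0" "z \<notin> S"
    by (auto simp: zeros_def)
  obtain r where r: "r > 0" "ball z r \<subseteq> - S"
    using \<open>closed S\<close> z(2) by (meson ComplI open_Compl open_contains_ball)
  obtain D where D: "\<And>N. degree (F N) \<le> D"
    using F by (auto simp: poly_tendsto_def)
  have "poly G x = 0" for x
  proof -
    have "\<forall>\<^sub>F N in sequentially.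
        cmod (poly (F N) x) \<le> cmod (poly (F N) z) * (1 + dist x z / r) ^ D"
      using ev
    proof eventually_elim
      case (elim N)
      show ?case
      proof (cases "F N = 0")
        case False
        with elim r(2) have "zeros (F N) \<inter> ball z r = {}" by blast
        then have "cmod (poly (F N) x) \<le> cmod (poly (F N) z) * (1 + dist x z / r) ^ degree (F N)"
          by (rule norm_poly_le_if_zero_free_ball[OF r(1)])
        \<comment> \<open>The exponent must not depend on \<open>N\<close> for the bound to survive
          the limit.\<close>
        also have "\<dots> \<le> cmod (poly (F N) z) * (1 + dist x z / r) ^ D"
          using r(1) D by (intro mult_left_mono power_increasing) auto
        finally show ?thesis .
      qed auto
    qed
    then have "cmod (poly G x) \<le> cmod (poly G z) * (1 + dist x z / r) ^ D"
      using F by (intro tendsto_le[OF sequentially_bot])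
        (auto intro!: tendsto_intros poly_tendsto_imp_tendsto_poly)
    then show ?thesis using z(1) by simp
  qed
  then show False
    using \<open>G \<noteq> 0\<close> poly_all_0_iff_0 by blast
qed

section \<open>Powers \<open>q ^ N\<close> as test polynomials\<close>

text \<open>
  The \<open>j\<close>-th derivative of \<open>q ^ N\<close> is divided by \<open>N ^ j\<close> as well as by \<open>q ^ (N - j)\<close>, so that
  the quotient converges as \<open>N\<close> grows.
\<close>

primrec deriv_cofactor :: "'a::real_normed_field poly \<Rightarrow> nat \<Rightarrow> nat \<Rightarrow> 'a poly" where
  "deriv_cofactor q 0 N = 1"
| "deriv_cofactor q (Suc j) N =
     smult (of_nat (N - j) / of_nat N) (pderiv q * deriv_cofactor q j N) +
     smult (1 / of_nat N) (q * pderiv (deriv_cofactor q j N))"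

lemma higher_pderiv_power:
  assumes "j \<le> N"
  shows "(pderiv ^^ j) (q ^ N) = smult (of_nat N ^ j) (q ^ (N - j) * deriv_cofactor q j N)"
  using assms
proof (induction j)
  case (Suc j)
  \<comment> \<open>Since \<open>j < N\<close>, a factor \<open>q\<close> is left to differentiate,
    and both terms of the product rule keep \<open>q ^ m\<close>.\<close>
  then obtain m where m: "N - j = Suc m" "N - Suc j = m"
    by (metis Suc_diff_Suc Suc_le_lessD)
  have [simp]: "N \<noteq> 0" using Suc.prems by auto
  have "(pderiv ^^ Suc j) (q ^ N)
      = smult (of_nat N ^ j) (pderiv (q ^ Suc m * deriv_cofactor q j N))"
    using Suc by (simp add: m pderiv_smult del: power_Suc)
  also have "pderiv (q ^ Suc m * deriv_cofactor q j N)
      = q ^ m * (smult (of_nat (Suc m)) (pderiv q * deriv_cofactor q j N)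
                 + q * pderiv (deriv_cofactor q j N))"
    by (simp add: pderiv_mult pderiv_power_Suc algebra_simps del: of_nat_Suc power_Suc)
      (simp add: mult_ac)
  also have "smult (of_nat (Suc m)) (pderiv q * deriv_cofactor q j N)
                 + q * pderiv (deriv_cofactor q j N)
      = smult (of_nat N) (deriv_cofactor q (Suc j) N)"
    by (simp add: m smult_add_right del: of_nat_Suc)
  finally show ?case
    by (simp add: m mult_ac del: funpow.simps deriv_cofactor.simps)
qed auto

text \<open>In the recursion \<open>(N - j) / N\<close> tends to 1 and \<open>1 / N\<close> to 0, so
  each step contributes just a factor \<open>pderiv q\<close> in the limit.\<close>

lemma poly_tendsto_deriv_cofactor: "poly_tendsto (deriv_cofactor q j) (pderiv q ^ j)"
proof (induction j)
  case (Suc j)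
  have "(\<lambda>N. 1 - of_nat j * inverse (of_nat N) :: 'a) \<longlonglongrightarrow> 1 - of_nat j * 0"
    by (intro tendsto_intros lim_inverse_n)
  moreover have "\<forall>\<^sub>F N in sequentially.
      1 - of_nat j * inverse (of_nat N) = (of_nat (N - j) / of_nat N :: 'a)"
    using eventually_ge_at_top[of "Suc j"]
    by eventually_elim (auto simp: field_simps of_nat_diff)
  ultimately have "(\<lambda>N. of_nat (N - j) / of_nat N :: 'a) \<longlonglongrightarrow> 1"
    using Lim_transform_eventually by fastforce
  then have "poly_tendsto (\<lambda>N. deriv_cofactor q (Suc j) N)
      (smult 1 (pderiv q * pderiv q ^ j) + smult 0 (q * pderiv (pderiv q ^ j)))"
    unfolding deriv_cofactor.simps
    by (intro poly_tendsto_add poly_tendsto_smult poly_tendsto_mult poly_tendsto_pderiv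
        poly_tendsto_const Suc lim_1_over_n)
  then show ?case by (simp del: deriv_cofactor.simps)
qed (auto simp: poly_tendsto_def)

lemma zeros_power_subset: "zeros q \<subseteq> S \<Longrightarrow> zeros (q ^ N) \<subseteq> S"
  by (auto simp: zeros_def)

lemma zeros_mult_subset: "zeros (p * q) \<subseteq> S \<longleftrightarrow> zeros p \<subseteq> S \<and> zeros q \<subseteq> S"
  by (auto simp: zeros_def)

lemma invariant_set_contains_symbol_zeros:
  assumes S: "S \<in> invariant_sets (diff_op k Q) n"
    and "degree q > 0" "zeros q \<subseteq> S" "Q k \<noteq> 0"
  shows "zeros (Q k * pderiv q ^ k) \<subseteq> S"
proof -
  \<comment> \<open>\<open>F N\<close> is \<open>diff_op k Q (q ^ N)\<close> divided by
    \<open>N ^ k * q ^ (N - k)\<close>; each term of order \<open>j\<close> retains the damping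
    factor \<open>(1 / N) ^ (k - j)\<close>.\<close>
  define F where "F N =
      (\<Sum>j\<le>k. smult ((1 / of_nat N) ^ (k - j)) (Q j * q ^ (k - j) * deriv_cofactor q j N))" for N
  have T: "diff_op k Q (q ^ N) = smult (of_nat N ^ k) (q ^ (N - k) * F N)" if "N > k" for N
  proof -
    have "Q j * (pderiv ^^ j) (q ^ N) = smult (of_nat N ^ k) (q ^ (N - k) *
        smult ((1 / of_nat N) ^ (k - j)) (Q j * q ^ (k - j) * deriv_cofactor q j N))"
      if "j \<le> k" for j
    proof -
      have "N - j = (N - k) + (k - j)"
        using that \<open>N > k\<close> by simp
      then have "q ^ (N - j) = q ^ (N - k) * q ^ (k - j)"
        by (simp add: power_add)
      moreover have "of_nat N ^ k * (1 / of_nat N) ^ (k - j) = (of_nat N ^ j :: complex)"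
        using that \<open>N > k\<close> by (simp add: power_diff power_divide)
      ultimately show ?thesis
        using that \<open>N > k\<close> by (simp add: higher_pderiv_power mult_ac)
    qed
    then have "diff_op k Q (q ^ N) = (\<Sum>j\<le>k. [:of_nat N ^ k:] * (q ^ (N - k) *
        smult ((1 / of_nat N) ^ (k - j)) (Q j * q ^ (k - j) * deriv_cofactor q j N)))"
      by (simp add: diff_op_def mult.commute)
    then show ?thesis
      by (simp only: F_def flip: sum_distrib_left) simp
  qed
  have "poly_tendsto F (\<Sum>j\<le>k. smult (0 ^ (k - j)) (Q j * q ^ (k - j) * pderiv q ^ j))"
    unfolding F_def
    by (intro poly_tendsto_sum poly_tendsto_smult poly_tendsto_mult poly_tendsto_const
        poly_tendsto_deriv_cofactor tendsto_power lim_1_over_n) auto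
  \<comment> \<open>\<open>0 ^ (k - j)\<close> is 1 for \<open>j = k\<close> and 0 for
    \<open>j < k\<close>: the leading term alone survives.\<close>
  also have "(\<Sum>j\<le>k. smult (0 ^ (k - j)) (Q j * q ^ (k - j) * pderiv q ^ j))
      = (\<Sum>j\<in>{k}. Q j * q ^ (k - j) * pderiv q ^ j)"
    by (intro sum.mono_neutral_cong_right) auto
  finally have lim: "poly_tendsto F (Q k * pderiv q ^ k)" by simp
  have "\<forall>\<^sub>F N in sequentially. F N = 0 \<or> zeros (F N) \<subseteq> S"
    \<comment> \<open>\<open>N > k\<close> makes \<open>T\<close> applicable; \<open>N > n\<close>
      gives \<open>q ^ N\<close> degree at least \<open>n\<close>.\<close>
    using eventually_gt_at_top[of "max k n"]
  proof eventually_elim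
    case (elim N)
    have "q \<noteq> 0" using assms(2) by auto
    then have "n \<le> degree (q ^ N)"
      using elim assms(2) mult_le_mono[of n N 1 "degree q"] \<open>q \<noteq> 0\<close> by (simp add: degree_power_eq)
    then have "diff_op k Q (q ^ N) = 0 \<or> zeros (diff_op k Q (q ^ N)) \<subseteq> S"
      using S zeros_power_subset[OF assms(3), of N] \<open>q \<noteq> 0\<close> by (auto simp: invariant_sets_def)
    \<comment> \<open>By \<open>T\<close>, \<open>F N\<close> is a factor of
      \<open>diff_op k Q (q ^ N)\<close> whose cofactor is nonzero, so both the vanishing and the
      location of zeros pass to \<open>F N\<close>.\<close>
    then show ?case
      using elim \<open>q \<noteq> 0\<close> by (auto simp: T zeros_def)
  qed
  then have "Q k * pderiv q ^ k = 0 \<or> zeros (Q k * pderiv q ^ k) \<subseteq> S"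
    using S lim by (intro zeros_limit_subset[of S F]) (auto simp: invariant_sets_def)
  moreover have "pderiv q \<noteq> 0"
    using assms(2) by (simp add: pderiv_eq_0_iff)
  ultimately show ?thesis
    using \<open>Q k \<noteq> 0\<close> by simp
qed

section \<open>Convexity\<close>

text \<open>By compactness there are points of \<open>S\<close> on the segment nearest to
  \<open>x\<close> on either side. Their midpoint lies in \<open>S\<close> too, which is impossible
  unless the gap between them is empty.\<close>

lemma closed_midpoint_imp_convex:
  fixes S :: "'a::real_normed_vector set"
  assumes "closed S" and mid: "\<And>a b. a \<in> S \<Longrightarrow> b \<in> S \<Longrightarrow> midpoint a b \<in> S"
  shows "convex S"
  unfolding convex_contains_segment
proof (intro ballI subsetI)
  fix a b x assume ab: "a \<in> S" "b \<in> S" and "x \<in> closed_segment a b"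
  define f where "f u = (1 - u) *\<^sub>R a + u *\<^sub>R b" for u
  obtain t where t: "0 \<le> t" "t \<le> 1" "x = f t"
    using \<open>x \<in> closed_segment a b\<close> by (auto simp: closed_segment_def f_def)
  have "closed (f -` S)"
    unfolding f_def by (intro continuous_closed_vimage \<open>closed S\<close> continuous_intros)
  then have "compact ({0..t} \<inter> f -` S)" "compact ({t..1} \<inter> f -` S)"
    by (auto intro: compact_Int_closed)
  moreover have "{0..t} \<inter> f -` S \<noteq> {}" "{t..1} \<inter> f -` S \<noteq> {}"
    using ab t by (auto simp: f_def intro!: exI[of _ "0::real"] exI[of _ "1::real"])
  ultimately obtain l u where
      l: "l \<in> {0..t} \<inter> f -` S" "\<forall>s \<in> {0..t} \<inter> f -` S. s \<le> l" and
      u: "u \<in> {t..1} \<inter> f -` S" "\<forall>s \<in> {t..1} \<inter> f -` S. u \<le> s"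
    using compact_attains_sup[of "{0..t} \<inter> f -` S"] compact_attains_inf[of "{t..1} \<inter> f -` S"]
    by metis
  have "f ((l + u) / 2) + f ((l + u) / 2) = f l + f u"
    by (simp add: f_def add_ac flip: scaleR_add_left)
  then have "f ((l + u) / 2) = midpoint (f l) (f u)"
    by (metis midpoint_eq_iff)
  then have "f ((l + u) / 2) \<in> S"
    using l(1) u(1) mid by simp
  \<comment> \<open>The midpoint falls on one side of \<open>t\<close>; the extremality of
    \<open>l\<close> or \<open>u\<close> there forces \<open>u\<close> \<le> \<open>l\<close>, while
    \<open>l\<close> \<le> \<open>t\<close> \<le> \<open>u\<close>.\<close>
  then have "(l + u) / 2 \<in> {0..t} \<inter> f -` S \<or> (l + u) / 2 \<in> {t..1} \<inter> f -` S"
    using l(1) u(1) by auto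
  then have "(l + u) / 2 \<le> l \<or> u \<le> (l + u) / 2"
    using l(2) u(2) by blast
  then have "l = t"
    using l(1) u(1) by auto
  then show "x \<in> S"
    using l(1) t(3) by simp
qed

lemma invariant_set_convex:
  assumes "k \<ge> 1" "Q k \<noteq> 0" and S: "S \<in> invariant_sets (diff_op k Q) n"
  shows "convex S"
proof (rule closed_midpoint_imp_convex)
  show "closed S" using S by (simp add: invariant_sets_def)
next
  fix a b assume ab: "a \<in> S" "b \<in> S"
  define q where "q = [:-a, 1:] * [:-b, 1:]"
  have "degree q > 0" "zeros q \<subseteq> S"
    using ab unfolding q_def zeros_mult_subset by (auto simp: zeros_def degree_mult_eq)
  then have "zeros (pderiv q ^ k) \<subseteq> S"
    using invariant_set_contains_symbol_zeros[of S k Q n q] S assms(2)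
    by (simp add: zeros_mult_subset)
  \<comment> \<open>The derivative is \<open>2 x - a - b\<close>.\<close>
  moreover have "poly (pderiv q) (midpoint a b) = 0"
    by (simp add: q_def pderiv_pCons midpoint_def scaleR_conv_of_real algebra_simps)
  ultimately show "midpoint a b \<in> S"
    using \<open>k \<ge> 1\<close> by (auto simp: zeros_def)
qed

section \<open>Unbounded invariant sets\<close>

lemma unbounded_invariant_set_T_invariant:
  assumes S: "S \<in> invariant_sets (diff_op k Q) n" and "\<not> bounded S"
  shows "T_invariant (diff_op k Q) S"
proof -
  have "closed S" using S by (simp add: invariant_sets_def)
  have "\<exists>w\<in>S. norm w > real N" for N
    using \<open>\<not> bounded S\<close> by (meson boundedI not_le)
  then obtain w where w: "\<And>N. w N \<in> S" "\<And>N. norm (w N) > real N"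
    by metis
  then have w0: "w N \<noteq> 0" for N
    by (metis norm_zero not_less of_nat_0_le_iff)
  have "filterlim (\<lambda>N. norm (w N)) at_top sequentially"
    using filterlim_real_sequentially by (rule filterlim_at_top_mono) (intro always_eventually allI less_imp_le w(2))
  then have "(\<lambda>N. - inverse (w N)) \<longlonglongrightarrow> - 0"
    by (intro tendsto_intros tendsto_inverse_0[THEN filterlim_compose])
      (simp add: filterlim_at_infinity_conv_norm_at_top)
  then have "poly_tendsto (\<lambda>N. [:1:] + smult (- inverse (w N)) [:0, 1:]) ([:1:] + smult (- 0) [:0, 1:])"
    by (intro poly_tendsto_add poly_tendsto_smult poly_tendsto_const)
  then have lin: "poly_tendsto (\<lambda>N. [:1, - inverse (w N):]) 1"
    by (simp add: one_pCons)
  have "diff_op k Q p = 0 \<or> zeros (diff_op k Q p) \<subseteq> S" if "p \<noteq> 0" "zeros p \<subseteq> S" for p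
  proof (rule zeros_limit_subset[OF \<open>closed S\<close>])
    \<comment> \<open>Each added factor has the single root \<open>w N\<close>, which lies in
      \<open>S\<close>. The \<open>n\<close> factors raise the degree to at least \<open>n\<close>,
      whatever the degree of \<open>p\<close>, and tend to 1.\<close>
    define P where "P N = p * [:1, - inverse (w N):] ^ n" for N
    have "poly_tendsto P (p * 1 ^ n)"
      unfolding P_def by (intro poly_tendsto_mult poly_tendsto_power poly_tendsto_const lin)
    then show "poly_tendsto (\<lambda>N. diff_op k Q (P N)) (diff_op k Q p)"
      by (simp add: poly_tendsto_diff_op)
    have "P N \<noteq> 0" "n \<le> degree (P N)" for N
      using \<open>p \<noteq> 0\<close> w0[of N] by (simp_all add: P_def degree_mult_eq degree_power_eq)
    moreover have "zeros [:1, - inverse (w N):] \<subseteq> S" for N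
      using w(1)[of N] w0[of N] by (auto simp: zeros_def field_simps)
    then have "zeros (P N) \<subseteq> S" for N
      using that(2) by (simp add: P_def zeros_mult_subset zeros_power_subset)
    ultimately show "\<forall>\<^sub>F N in sequentially. diff_op k Q (P N) = 0 \<or> zeros (diff_op k Q (P N)) \<subseteq> S"
      using S by (auto simp: invariant_sets_def)
  qed
  then show ?thesis
    using \<open>closed S\<close> by (simp add: T_invariant_def invariant_sets_def)
qed

section \<open>The fundamental polygon and the minimal set\<close>

lemma fundamental_polygon_subset_invariant_set:
  assumes "k \<ge> 1" "Q k \<noteq> 0" and S: "S \<in> invariant_sets (diff_op k Q) n" "S \<noteq> {}"
  shows "fundamental_polygon k Q \<subseteq> S"
proof -
  obtain a where "a \<in> S" using S(2) by blast
  \<comment> \<open>The test polynomial \<open>x - a\<close> has derivative 1, so the symbol reduces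
    to \<open>Q k\<close>; a point \<open>a\<close> of \<open>S\<close> is what makes it
    admissible.\<close>
  then have "zeros (Q k * pderiv [:-a, 1:] ^ k) \<subseteq> S"
    using S(1) assms(2) by (intro invariant_set_contains_symbol_zeros) (auto simp: zeros_def)
  then have "zeros (Q k) \<subseteq> S"
    by (simp add: zeros_mult_subset)
  then show ?thesis
    unfolding fundamental_polygon_def
    using invariant_set_convex assms by (intro hull_minimal) blast+
qed

lemma Inter_invariant_sets:
  assumes "\<And>S. S \<in> C \<Longrightarrow> S \<in> invariant_sets T n"
  shows "\<Inter>C \<in> invariant_sets T n"
proof -
  have "closed (\<Inter>C)"
    using assms by (intro closed_Inter) (auto simp: invariant_sets_def)
  moreover have "T p = 0 \<or> zeros (T p) \<subseteq> \<Inter>C"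
    if "p \<noteq> 0" "degree p \<ge> n" "zeros p \<subseteq> \<Inter>C" for p
    using that assms by (fastforce simp: invariant_sets_def)
  ultimately show ?thesis
    by (simp add: invariant_sets_def)
qed

text \<open>The common subset \<open>M\<close> keeps the intersection of all nonempty invariant sets
  nonempty. That intersection is then a least element, hence the only minimal one.\<close>

lemma unique_minimal_invariant:
  assumes "M \<noteq> {}" "\<And>S. S \<in> invariant_sets T n \<Longrightarrow> S \<noteq> {} \<Longrightarrow> M \<subseteq> S"
  shows "\<exists>!S. minimal_invariant T n S"
proof
  let ?I = "\<Inter>{S \<in> invariant_sets T n. S \<noteq> {}}"
  have I: "?I \<in> invariant_sets T n" "closed ?I"
  proof -
    show "?I \<in> invariant_sets T n" by (rule Inter_invariant_sets) blast
    then show "closed ?I" by (simp add: invariant_sets_def)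
  qed
  have "M \<subseteq> ?I" using assms(2) by blast
  with assms(1) have ne: "?I \<noteq> {}" by blast
  show "minimal_invariant T n ?I"
    unfolding minimal_invariant_def using I ne by blast
  show "S = ?I" if "minimal_invariant T n S" for S
  proof -
    have "S \<in> invariant_sets T n" "S \<noteq> {}"
      using that by (auto simp: minimal_invariant_def)
    then have "?I \<subseteq> S" by blast
    moreover have "\<not> ?I \<subset> S"
      using that I ne unfolding minimal_invariant_def by metis
    ultimately show ?thesis by (metis psubsetI)
  qed
qed

theorem theorem2p2:
  fixes k n :: nat and Q :: "nat \<Rightarrow> complex poly"
  assumes "k \<ge> 1" and "Q k \<noteq> 0"
  shows "(\<forall>S \<in> invariant_sets (diff_op k Q) n. S \<noteq> {} \<longrightarrow> convex S) \<and>
         (\<forall>S \<in> invariant_sets (diff_op k Q) n. \<not> bounded S \<longrightarrow> T_invariant (diff_op k Q) S) \<and>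
         (degree (Q k) > 0 \<longrightarrow>
            (\<forall>S \<in> invariant_sets (diff_op k Q) n. S \<noteq> {} \<longrightarrow> fundamental_polygon k Q \<subseteq> S)) \<and>
         (degree (Q k) > 0 \<longrightarrow> (\<exists>!S. minimal_invariant (diff_op k Q) n S))"
proof (intro conjI impI ballI)
  assume "degree (Q k) > 0"
  then have "\<not> constant (poly (Q k))"
    by (simp add: constant_degree)
  then have "zeros (Q k) \<noteq> {}"
    using fundamental_theorem_of_algebra by (auto simp: zeros_def)
  \<comment> \<open>The polygon serves as the nonempty common subset \<open>M\<close>.\<close>
  then have "fundamental_polygon k Q \<noteq> {}"
    by (simp add: fundamental_polygon_def)
  then show "\<exists>!S. minimal_invariant (diff_op k Q) n S"
    using fundamental_polygon_subset_invariant_set[where Q = Q, OF assms]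
    by (rule unique_minimal_invariant)
next
  fix S assume S: "S \<in> invariant_sets (diff_op k Q) n"
  show "convex S"
    using assms S by (rule invariant_set_convex)
  show "T_invariant (diff_op k Q) S" if "\<not> bounded S"
    using S that by (rule unbounded_invariant_set_T_invariant)
  show "fundamental_polygon k Q \<subseteq> S" if "S \<noteq> {}"
    using assms S that by (rule fundamental_polygon_subset_invariant_set)
qed

end
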